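(* Let $P\in\mathbb{R}[x]$ and $a<b$ real numbers with $P(a)\neq 0$ and $P(b)\neq 0$. Then $\mathrm{Num}_{\mathbb{R}}(P;(a,b)) = \mathrm{Var}(\mathrm{SRemSE}(P,P');a,b)$, where $P'$ is the derivative of $P$.
   Context: The extended signed remainder sequence $\mathrm{SRemSE}(p,q)$ of real polynomials is the list defined recursively by: $\mathrm{SRemSE}(p,q) = []$ if $p=0$; otherwise, if $p \bmod q \neq 0$ then $\mathrm{SRemSE}(p,q) = p :: \mathrm{SRemSE}(q, -(p \bmod q))$, and if $p \bmod q = 0$ then $\mathrm{SRemSE}(p,q) = p :: \mathrm{SRemSE}(q, q')$, where $::$ prepends an element to a list, $q'$ is the derivative of $q$, and $p \bmod 0 = p$. For a list of real numbers, $\mathrm{Var}$ counts sign changes between consecutive entries after deleting zeros; for a list of polynomials $L=[P_1,\dots,P_m]$, $\mathrm{Var}(L;c)=\mathrm{Var}([P_1(c),\dots,P_m(c)])$ and $\mathrm{Var}(L;a,b)=\mathrm{Var}(L;a)-\mathrm{Var}(L;b)$. $\mathrm{Num}_{\mathbb{R}}(P;S)$ is the number of real roots of $P$ in $S$ counted with multiplicity. *)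

theory Defs
  imports Complex_Main "HOL-Computational_Algebra.Polynomial"
begin

text \<open>
  The convention \<open>p mod 0 = p\<close> is the library's. In the last branch \<open>q \<noteq> 0\<close>,
  since \<open>p \<noteq> 0\<close> and \<open>p mod q = 0\<close>.
\<close>

function SRemSE :: "real poly \<Rightarrow> real poly \<Rightarrow> real poly list" where
  "SRemSE p q =
     (if p = 0 then []
      else if p mod q \<noteq> 0 then p # SRemSE q (- (p mod q))
      else p # SRemSE q (pderiv q))"
  by auto
termination
proof (relation "measure (\<lambda>(p, q). if p = 0 then 0 else if q = 0 then 1 else 2 + degree q)",
    goal_cases)
  case 1
  show ?case by simp
next
  case (2 p q)
  then show ?case using degree_mod_less[of q p] by auto
next
  case (3 p q)
  then have "q \<noteq> 0" by auto
  moreover have "pderiv q = 0 \<or> degree (pderiv q) < degree q"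
    by (auto simp: degree_pderiv pderiv_eq_0_iff)
  ultimately show ?case using 3 by auto
qed

text \<open>\<open>SRemSE.simps\<close> has an unrestricted left-hand side and would loop as a rewrite rule.\<close>

declare SRemSE.simps [simp del]

definition Var :: "real list \<Rightarrow> nat" where
  "Var xs = (let ys = filter (\<lambda>x. x \<noteq> 0) xs
             in card {i. Suc i < length ys \<and> ys ! i * ys ! Suc i < 0})"

definition Var_at :: "real poly list \<Rightarrow> real \<Rightarrow> nat" where
  "Var_at L c = Var (map (\<lambda>p. poly p c) L)"

text \<open>Integer-valued, because the difference may be negative for a general list.\<close>

definition Var_between :: "real poly list \<Rightarrow> real \<Rightarrow> real \<Rightarrow> int" where
  "Var_between L a b = int (Var_at L a) - int (Var_at L b)"

text \<open>Only meaningful for \<open>P \<noteq> 0\<close>, where the set of roots is finite.\<close>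

definition Num_real :: "real poly \<Rightarrow> real set \<Rightarrow> nat" where
  "Num_real P S = (\<Sum>x\<in>{x \<in> S. poly P x = 0}. order x P)"

end

theory Submission
  imports Defs
begin

text \<open>
  Evaluate the sequence just to the left and just to the right of a point \<open>c\<close>. For nonzero
  \<open>p\<close>, \<open>q\<close>, induction along the remainder sequence shows that the number of variations of
  \<open>SRemSE p q\<close> drops at \<open>c\<close> by the jump of \<open>q / p\<close> at \<open>c\<close> (a Cauchy index) plus the
  multiplicity of \<open>c\<close> in \<open>gcd p q\<close>; for \<open>q = p'\<close> this is the multiplicity of \<open>c\<close> in \<open>p\<close>.
  The local drops are added up by bisection. At an end point the
  plain value of the number of variations agrees with the one-sided one, because an entry
  vanishing there is surrounded by entries of opposite signs.
\<close>

section \<open>Recursion for sign variations of real lists\<close>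

lemma Var_singleton [simp]: "Var [x] = 0"
  by (simp add: Var_def)

lemma Var_Cons_Cons_0 [simp]: "Var (x # 0 # xs) = Var (x # xs)"
  by (simp add: Var_def)

lemma Var_Cons_Cons:
  assumes "x \<noteq> 0" "y \<noteq> 0"
  shows "Var (x # y # xs) = (if x * y < 0 then 1 else 0) + Var (y # xs)"
proof -
  define zs where "zs = y # filter (\<lambda>x. x \<noteq> 0) xs"
  define A where "A = {i. Suc i < length zs \<and> zs ! i * zs ! Suc i < 0}"
  have fin: "finite A"
    by (rule finite_subset[of _ "{..<length zs}"]) (auto simp: A_def)
  \<comment> \<open>Index 0 compares \<open>x\<close> with \<open>y\<close>, the head of
    \<open>zs\<close>; the other indices are those of \<open>A\<close> shifted by one.\<close>
  have "{i. Suc i < length (x # zs) \<and> (x # zs) ! i * (x # zs) ! Suc i < 0}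
      = (if x * y < 0 then {0} else {}) \<union> Suc ` A" (is "?L = ?R")
  proof (rule set_eqI)
    fix i show "i \<in> ?L \<longleftrightarrow> i \<in> ?R"
      by (cases i) (auto simp: A_def zs_def)
  qed
  moreover have "card \<dots> = (if x * y < 0 then 1 else 0) + card A"
    using fin by (auto simp: card_image)
  ultimately show ?thesis
    using assms by (simp add: Var_def Let_def A_def zs_def)
qed

section \<open>Orders and one-sided signs at a point\<close>

text \<open>For nonzero \<open>p\<close> this is the sign of \<open>p\<close> just to the right of
  \<open>c\<close>, in algebraic form: the power of \<open>x - c\<close> divided out is positive
  there, so the cofactor decides. To the left that power has sign \<open>(- 1) ^ order c p\<close>,
  whence \<open>sgn_left\<close>.\<close>

definition sgn_right :: "real poly \<Rightarrow> real \<Rightarrow> real" where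
  "sgn_right p c = sgn (poly (p div [:- c, 1:] ^ order c p) c)"

definition sgn_left :: "real poly \<Rightarrow> real \<Rightarrow> real" where
  "sgn_left p c = (- 1) ^ order c p * sgn_right p c"

lemma order_sgn_right_unique:
  assumes "p = [:- c, 1:] ^ n * p1" "poly p1 c \<noteq> 0"
  shows "order c p = n" "sgn_right p c = sgn (poly p1 c)"
proof -
  have "p1 \<noteq> 0" using assms(2) by auto
  moreover have "order c p1 = 0" using assms(2) by (simp add: order_root)
  ultimately show *: "order c p = n"
    using assms(1) by (simp add: order_mult order_power_n_n)
  show "sgn_right p c = sgn (poly p1 c)"
    unfolding sgn_right_def * using assms(1) by simp
qed

lemma order_factorization:
  assumes "p \<noteq> (0 :: real poly)"
  obtains p1 where "p = [:- c, 1:] ^ order c p * p1" "poly p1 c \<noteq> 0"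
    "sgn_right p c = sgn (poly p1 c)"
proof -
  from order_decomp[OF assms, of c] obtain p1
    where "p = [:- c, 1:] ^ order c p * p1" "\<not> [:- c, 1:] dvd p1" by blast
  moreover from this have "poly p1 c \<noteq> 0" by (simp add: poly_eq_0_iff_dvd)
  ultimately show thesis using that order_sgn_right_unique(2) by blast
qed

lemma sgn_right_cases:
  assumes "p \<noteq> 0"
  shows "sgn_right p c = 1 \<or> sgn_right p c = -1"
  using order_factorization[OF assms, of c] by (metis sgn_real_def)

lemma sgn_right_nonroot: "poly p c \<noteq> 0 \<Longrightarrow> sgn_right p c = sgn (poly p c)"
  using order_sgn_right_unique(2)[of p c 0 p] by simp

lemma order_sgn_right_minus:
  assumes "p \<noteq> 0"
  shows "order c (- p) = order c p" "sgn_right (- p) c = - sgn_right p c"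
proof -
  obtain p1 where p1: "p = [:- c, 1:] ^ order c p * p1" "poly p1 c \<noteq> 0"
    "sgn_right p c = sgn (poly p1 c)" using order_factorization[OF assms] .
  then have "- p = [:- c, 1:] ^ order c p * (- p1)" by (metis mult_minus_right)
  from order_sgn_right_unique[OF this] p1(2,3)
  show "order c (- p) = order c p" "sgn_right (- p) c = - sgn_right p c"
    by (simp_all add: sgn_minus)
qed

text \<open>\<open>q * s\<close> is divisible by \<open>x - c\<close> to the power
  \<open>Suc (order c p)\<close>, so its share of the cofactor vanishes at \<open>c\<close>.\<close>

lemma order_sgn_right_add:
  assumes "p \<noteq> 0" "q \<noteq> 0" "order c p < order c q"
  shows "order c (p + q * s) = order c p" "sgn_right (p + q * s) c = sgn_right p c"
proof -
  obtain p1 where p1: "p = [:- c, 1:] ^ order c p * p1" "poly p1 c \<noteq> 0"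
    "sgn_right p c = sgn (poly p1 c)" using order_factorization[OF assms(1)] .
  have "[:- c, 1:] ^ Suc (order c p) dvd q"
    using assms by (meson Suc_leI dvd_trans le_imp_power_dvd order_1)
  then obtain q1 where q1: "q = [:- c, 1:] ^ Suc (order c p) * q1" by (elim dvdE)
  have "p + q * s = [:- c, 1:] ^ order c p * p1 + [:- c, 1:] ^ Suc (order c p) * q1 * s"
    using p1(1) q1 by simp
  also have "\<dots> = [:- c, 1:] ^ order c p * (p1 + [:- c, 1:] * (q1 * s))"
    unfolding power_Suc by (simp only: algebra_simps)
  finally have "p + q * s = [:- c, 1:] ^ order c p * (p1 + [:- c, 1:] * (q1 * s))" .
  from order_sgn_right_unique[OF this] p1(2,3)
  show "order c (p + q * s) = order c p" "sgn_right (p + q * s) c = sgn_right p c"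
    by simp_all
qed

text \<open>With \<open>p\<close> written as \<open>(x - c) ^ Suc n * p1\<close>, the derivative has
  the factor \<open>(x - c) ^ n\<close> and a cofactor with value \<open>Suc n * poly p1 c\<close>
  at \<open>c\<close>.\<close>

lemma order_sgn_right_pderiv:
  assumes "p \<noteq> 0" "order c p \<noteq> 0"
  shows "Suc (order c (pderiv p)) = order c p" "sgn_right (pderiv p) c = sgn_right p c"
proof -
  obtain p1 where p1: "p = [:- c, 1:] ^ order c p * p1" "poly p1 c \<noteq> 0"
    "sgn_right p c = sgn (poly p1 c)" using order_factorization[OF assms(1)] .
  obtain n where n: "order c p = Suc n" using assms(2) by (cases "order c p") auto
  have "pderiv p = pderiv ([:- c, 1:] ^ Suc n * p1)" using p1(1) n by simp
  also have "\<dots> = [:- c, 1:] ^ n * (smult (of_nat (Suc n)) p1 + [:- c, 1:] * pderiv p1)"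
    unfolding pderiv_mult pderiv_power_Suc
    by (simp add: pderiv_pCons algebra_simps flip: one_pCons del: of_nat_Suc mult_pCons_left mult_pCons_right)
  finally have eq: "pderiv p
    = [:- c, 1:] ^ n * (smult (of_nat (Suc n)) p1 + [:- c, 1:] * pderiv p1)" .
  have val: "poly (smult (of_nat (Suc n)) p1 + [:- c, 1:] * pderiv p1) c = of_nat (Suc n) * poly p1 c"
    by simp
  have nz: "poly (smult (of_nat (Suc n)) p1 + [:- c, 1:] * pderiv p1) c \<noteq> 0"
    unfolding val using p1(2) by simp
  show "Suc (order c (pderiv p)) = order c p"
    using order_sgn_right_unique(1)[OF eq nz] n by simp
  show "sgn_right (pderiv p) c = sgn_right p c"
    using order_sgn_right_unique(2)[OF eq nz] p1(3) unfolding val by (simp add: sgn_mult)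
qed

lemma order_eq_0_if_pderiv_eq_0:
  assumes "(p :: real poly) \<noteq> 0" "pderiv p = 0"
  shows "order c p = 0"
proof -
  from assms(2) obtain k where "p = [:k:]" by (metis degree_eq_zeroE pderiv_eq_0_iff)
  then show ?thesis using assms(1) by (simp add: order_0I)
qed

text \<open>Links the algebraic signs to actual values. The point \<open>y = c\<close> is covered as
  well: \<open>0 ^ order c p\<close> is 1 at a nonroot and 0 at a root.\<close>

lemma eventually_sgn_poly:
  assumes "p \<noteq> 0"
  shows "eventually (\<lambda>y. sgn (poly p y) = sgn (y - c) ^ order c p * sgn_right p c) (nhds c)"
proof -
  obtain p1 where p1: "p = [:- c, 1:] ^ order c p * p1" "poly p1 c \<noteq> 0"
    "sgn_right p c = sgn (poly p1 c)" using order_factorization[OF assms] .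
  have "((\<lambda>y. poly p1 y) \<longlongrightarrow> poly p1 c) (nhds c)"
    by (intro tendsto_intros filterlim_ident)
  \<comment> \<open>The limit is the square of \<open>poly p1 c\<close>, hence positive, so
    \<open>p1\<close> keeps its sign near \<open>c\<close>.\<close>
  from tendsto_mult[OF this tendsto_const[of "poly p1 c"]]
  have "eventually (\<lambda>y. 0 < poly p1 y * poly p1 c) (nhds c)"
    by (rule order_tendstoD(1)) (use p1(2) in \<open>auto simp: zero_less_mult_iff linorder_neq_iff\<close>)
  then show ?thesis
  proof eventually_elim
    case (elim y)
    have "poly p y = (y - c) ^ order c p * poly p1 y"
      by (subst p1(1)) (simp add: poly_power)
    moreover have "sgn (x ^ n) = sgn x ^ n" for x :: real and n
      by (induction n) (simp_all add: sgn_mult)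
    ultimately have "sgn (poly p y) = sgn (y - c) ^ order c p * sgn (poly p1 y)"
      by (simp add: sgn_mult)
    moreover have "sgn (poly p1 y) = sgn (poly p1 c)"
      using elim by (auto simp: zero_less_mult_iff)
    ultimately show ?case using p1(3) by simp
  qed
qed

section \<open>Shape of the sequence and its variations on either side of a point\<close>

lemma SRemSE_0_right: "p \<noteq> 0 \<Longrightarrow> SRemSE p 0 = [p]"
  by (simp add: SRemSE.simps)

lemma SRemSE_nonzero: "p \<in> set (SRemSE f g) \<Longrightarrow> p \<noteq> 0"
proof (induction f g rule: SRemSE.induct)
  case (1 f g)
  from 1(3) have "p \<in> set (if f = 0 then [] else if f mod g \<noteq> 0 then f # SRemSE g (- (f mod g))
      else f # SRemSE g (pderiv g))"
    by (subst (asm) SRemSE.simps)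
  with 1(1,2) show ?case by (auto split: if_splits)
qed

lemma SRemSE_Cons: "p \<noteq> 0 \<Longrightarrow> \<exists>t. SRemSE p q = p # SRemSE q t"
  by (subst SRemSE.simps) auto

abbreviation Var_right :: "real poly list \<Rightarrow> real \<Rightarrow> nat" where
  "Var_right L c \<equiv> Var (map (\<lambda>p. sgn_right p c) L)"

abbreviation Var_left :: "real poly list \<Rightarrow> real \<Rightarrow> nat" where
  "Var_left L c \<equiv> Var (map (\<lambda>p. sgn_left p c) L)"

text \<open>The share of an adjacent pair \<open>p\<close>, \<open>q\<close> in the loss of
  variations when \<open>c\<close> is crossed from left to right.\<close>

definition sgn_drop :: "real poly \<Rightarrow> real poly \<Rightarrow> real \<Rightarrow> int" where
  "sgn_drop p q c = (if sgn_left p c * sgn_left q c < 0 then 1 else 0)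
     - (if sgn_right p c * sgn_right q c < 0 then 1 else 0)"

lemma sgn_left_cases:
  assumes "p \<noteq> 0"
  shows "sgn_left p c = 1 \<or> sgn_left p c = -1"
  using sgn_right_cases[OF assms, of c] by (cases "even (order c p)") (auto simp: sgn_left_def)

lemma Var_drop_Cons_Cons:
  assumes "p \<noteq> 0" "q \<noteq> 0"
  shows "int (Var_left (p # q # L) c) - int (Var_right (p # q # L) c)
    = sgn_drop p q c + (int (Var_left (q # L) c) - int (Var_right (q # L) c))"
proof -
  have "sgn_right p c \<noteq> 0" "sgn_right q c \<noteq> 0" "sgn_left p c \<noteq> 0" "sgn_left q c \<noteq> 0"
    using assms[THEN sgn_right_cases, of c] assms[THEN sgn_left_cases, of c] by auto
  then show ?thesis by (simp add: Var_Cons_Cons sgn_drop_def)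
qed

text \<open>Both signs change by the same factor across \<open>c\<close>, and it cancels in the
  product.\<close>

lemma sgn_drop_order_eq: "order c p = order c q \<Longrightarrow> sgn_drop p q c = 0"
  by (cases "even (order c q)") (auto simp: sgn_drop_def sgn_left_def)

text \<open>\<open>r\<close> has the signs of \<open>- p\<close> on both sides of \<open>c\<close>,
  which exchanges variations and permanences.\<close>

lemma sgn_drop_uminus:
  assumes "p \<noteq> 0" "q \<noteq> 0" "order c r = order c p" "sgn_right r c = - sgn_right p c"
  shows "sgn_drop q r c = - sgn_drop p q c"
  using sgn_right_cases[OF assms(1), of c] sgn_right_cases[OF assms(2), of c] assms(3,4)
  by (cases "even (order c p)"; cases "even (order c q)")
    (auto simp: sgn_drop_def sgn_left_def)

text \<open>Near a root, \<open>p\<close> and \<open>pderiv p\<close> agree in sign on the right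
  and, their orders differing by one, disagree on the left.\<close>

lemma sgn_drop_pderiv:
  assumes "p \<noteq> 0" "order c p \<noteq> 0"
  shows "sgn_drop p (pderiv p) c = 1"
proof -
  have "sgn_left (pderiv p) c = - sgn_left p c"
    using order_sgn_right_pderiv[OF assms] by (simp add: sgn_left_def flip: \<open>Suc _ = _\<close>)
  then show ?thesis
    using order_sgn_right_pderiv(2)[OF assms] sgn_right_cases[OF assms(1), of c]
      sgn_left_cases[OF assms(1), of c]
    by (auto simp: sgn_drop_def)
qed

section \<open>Local Cauchy index along the sequence\<close>

text \<open>For nonzero \<open>p\<close> and \<open>q\<close>, the Cauchy index of
  \<open>q / p\<close> at \<open>c\<close>: 1 for a jump from negative to positive infinity, -1 for
  the reverse, 0 if there is no pole or no change of sign.\<close>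

definition jump :: "real poly \<Rightarrow> real poly \<Rightarrow> real \<Rightarrow> int" where
  "jump p q c = (if order c q < order c p then sgn_drop p q c else 0)"

lemma jump_pderiv:
  assumes "p \<noteq> 0"
  shows "jump p (pderiv p) c + int (min (order c p) (order c (pderiv p))) = int (order c p)"
  using order_sgn_right_pderiv(1)[OF assms, of c] sgn_drop_pderiv[OF assms, of c]
  by (cases "order c p = 0") (auto simp: jump_def min_def)

text \<open>If \<open>p\<close> has smaller order than \<open>q\<close>, then \<open>r\<close>
  behaves like \<open>- p\<close> at \<open>c\<close>, so \<open>jump q r c\<close> cancels
  \<open>sgn_drop p q c\<close>. Otherwise both minima equal \<open>order c q\<close>,
  \<open>jump q r c\<close> is 0, and \<open>jump p q c\<close> is
  \<open>sgn_drop p q c\<close>.\<close>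

lemma jump_remainder:
  fixes p q :: "real poly"
  assumes "p \<noteq> 0" "q \<noteq> 0" "p mod q \<noteq> 0"
  defines "r \<equiv> - (p mod q)"
  shows "jump p q c + int (min (order c p) (order c q))
    = sgn_drop p q c + (jump q r c + int (min (order c q) (order c r)))"
proof -
  have r: "r \<noteq> 0" and p: "p = - r + q * (p div q)" and r': "- r = p + q * (- (p div q))"
    using assms by (simp_all add: minus_mult_div_eq_mod)
  show ?thesis
  proof (cases "order c p < order c q")
    case True
    have "order c r = order c p" "sgn_right r c = - sgn_right p c"
      using order_sgn_right_add[OF assms(1,2) True, of "- (p div q)", folded r']
        order_sgn_right_minus[OF r, of c] by simp_all
    then show ?thesis
      using True sgn_drop_uminus[OF assms(1,2)] by (simp add: jump_def)
  next
    case False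
    have "order c q \<le> order c r"
    \<comment> \<open>If \<open>r\<close> had smaller order than \<open>q\<close>, then
      \<open>p = - r + q * (p div q)\<close> would inherit it, against the case assumption.\<close>
    proof (rule ccontr)
      assume "\<not> order c q \<le> order c r"
      then have "order c (- r + q * (p div q)) = order c r"
        using order_sgn_right_add(1)[of "- r" q c] r assms(2) order_sgn_right_minus(1)[OF r, of c]
        by simp
      then have "order c p = order c r" by (simp only: flip: p)
      with False \<open>\<not> order c q \<le> order c r\<close> show False by simp
    qed
    then show ?thesis
      using False sgn_drop_order_eq[of c p q] by (auto simp: jump_def min_def)
  qed
qed

lemma jump_divides:
  fixes p q :: "real poly"
  assumes "p \<noteq> 0" "q dvd p"
  shows "jump p q c + int (min (order c p) (order c q)) = sgn_drop p q c + int (order c q)"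
  using dvd_imp_order_le[OF assms, of c] sgn_drop_order_eq[of c p q]
  by (auto simp: jump_def min_def)

text \<open>Each step splits off the leading pair. Once \<open>q\<close> divides \<open>p\<close>,
  the restart with \<open>q\<close> and \<open>pderiv q\<close> contributes exactly
  \<open>order c q\<close>, the multiplicity of \<open>c\<close> in the gcd; this is the purpose of
  the extension.\<close>

lemma Var_drop_SRemSE:
  assumes "p \<noteq> 0" "q \<noteq> 0"
  shows "int (Var_left (SRemSE p q) c) - int (Var_right (SRemSE p q) c)
    = jump p q c + int (min (order c p) (order c q))"
  using assms
proof (induction p q rule: SRemSE.induct)
  case (1 p q)
  note p = 1(3) and q = 1(4)
  show ?case
  proof (cases "p mod q = 0")
    case False
    let ?r = "- (p mod q)"
    obtain L where L: "SRemSE q ?r = q # L" using SRemSE_Cons[OF q] by blast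
    have "SRemSE p q = p # SRemSE q ?r" using p False by (subst SRemSE.simps) simp
    then show ?thesis
      using Var_drop_Cons_Cons[OF p q, of c L] 1(1)[OF p] False q L
        jump_remainder[OF p q False, of c] by simp
  next
    case True
    obtain L where L: "SRemSE q (pderiv q) = q # L" using SRemSE_Cons[OF q] by blast
    have eq: "SRemSE p q = p # SRemSE q (pderiv q)" using p True by (subst SRemSE.simps) simp
    have "int (Var_left (SRemSE q (pderiv q)) c) - int (Var_right (SRemSE q (pderiv q)) c)
        = int (order c q)"
    \<comment> \<open>If \<open>q\<close> is constant, the restarted sequence is \<open>[q]\<close>
      and both sides are 0.\<close>
    proof (cases "pderiv q = 0")
      case True
      with q show ?thesis by (simp add: SRemSE_0_right order_eq_0_if_pderiv_eq_0)
    next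
      case False
      then show ?thesis using 1(2)[OF p] True q jump_pderiv[OF q] by simp
    qed
    then show ?thesis
      using Var_drop_Cons_Cons[OF p q, of c L] L eq jump_divides[OF p, of q c] True
      by (simp add: mod_eq_0_iff_dvd)
  qed
qed

lemma Var_drop_SRemSE_pderiv:
  assumes "p \<noteq> 0"
  shows "int (Var_left (SRemSE p (pderiv p)) c) - int (Var_right (SRemSE p (pderiv p)) c)
    = int (order c p)"
proof (cases "pderiv p = 0")
  case True
  with assms show ?thesis by (simp add: SRemSE_0_right order_eq_0_if_pderiv_eq_0)
next
  case False
  with Var_drop_SRemSE[OF assms False] jump_pderiv[OF assms] show ?thesis by simp
qed

section \<open>Variations at a point compared with those just to its right\<close>

text \<open>
  The second conjunct carries the induction across an entry \<open>p\<close> that vanishes at \<open>c\<close>, where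
  two steps of the recursion are needed.
\<close>

lemma Var_at_SRemSE_aux:
  "(poly p c \<noteq> 0 \<longrightarrow> Var_at (SRemSE p q) c = Var_right (SRemSE p q) c) \<and>
   (p \<noteq> 0 \<longrightarrow> poly q c \<noteq> 0 \<longrightarrow> Var_at (tl (SRemSE p q)) c = Var_right (tl (SRemSE p q)) c)"
proof (induction p q rule: SRemSE.induct)
  case (1 p q)
  \<comment> \<open>Both branches continue with \<open>q\<close> in front, so the first conjunct of
    the induction hypothesis applies to the tail.\<close>
  have step: "\<exists>t. SRemSE p q = p # SRemSE q t \<and> Var_at (SRemSE q t) c = Var_right (SRemSE q t) c"
    if p: "p \<noteq> 0" and q: "poly q c \<noteq> 0"
  proof (cases "p mod q = 0")
    case True
    have "SRemSE p q = p # SRemSE q (pderiv q)" using p True by (subst SRemSE.simps) simp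
    with 1(2)[OF p] True q show ?thesis by blast
  next
    case False
    have "SRemSE p q = p # SRemSE q (- (p mod q))" using p False by (subst SRemSE.simps) simp
    with 1(1)[OF p False] q show ?thesis by blast
  qed
  show ?case
  proof (intro conjI impI)
    assume "p \<noteq> 0" "poly q c \<noteq> 0"
    from step[OF this] show "Var_at (tl (SRemSE p q)) c = Var_right (tl (SRemSE p q)) c"
      by force
  next
    assume pc: "poly p c \<noteq> 0"
    then have p: "p \<noteq> 0" by auto
    consider "q = 0" | "poly q c \<noteq> 0" | "q \<noteq> 0" "poly q c = 0" by blast
    then show "Var_at (SRemSE p q) c = Var_right (SRemSE p q) c"
    proof cases
      case 1
      with p show ?thesis by (simp add: SRemSE_0_right Var_at_def)
    next
      case 2
      then have q: "q \<noteq> 0" by auto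
      obtain t where t: "SRemSE p q = p # SRemSE q t"
        "Var_at (SRemSE q t) c = Var_right (SRemSE q t) c"
        using step[OF p 2] by blast
      obtain L where "SRemSE q t = q # L" using SRemSE_Cons[OF q] by blast
      with t show ?thesis using pc 2
        by (simp add: Var_at_def Var_Cons_Cons sgn_right_nonroot sgn_eq_0_iff flip: sgn_mult)
    next
      case 3
      let ?r = "- (p mod q)"
      \<comment> \<open>The multiple of \<open>q\<close> vanishes at \<open>c\<close>. In particular
        the remainder is nonzero, so the recursion takes the remainder branch.\<close>
      have rc: "poly ?r c = - poly p c"
        using 3(2) by (simp flip: minus_mult_div_eq_mod)
      with pc have r: "?r \<noteq> 0" and m: "p mod q \<noteq> 0" by auto
      have eq: "SRemSE p q = p # SRemSE q ?r" using p m by (subst SRemSE.simps) simp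
      obtain t where t: "SRemSE q ?r = q # SRemSE ?r t"
        using SRemSE_Cons[OF 3(1)] by blast
      obtain L where L: "SRemSE ?r t = ?r # L" using SRemSE_Cons[OF r] by blast
      \<comment> \<open>The second conjunct for the pair \<open>q\<close>, \<open>?r\<close>: the
        tail of its sequence starts at \<open>?r\<close>.\<close>
      have IH: "Var_at (SRemSE ?r t) c = Var_right (SRemSE ?r t) c"
        using 1(1)[OF p m] 3(1) rc pc t by simp
      have "Var_at (SRemSE p q) c = 1 + Var_at (SRemSE ?r t) c"
        using pc rc 3(2) by (simp add: eq t L Var_at_def Var_Cons_Cons flip: power2_eq_square)
      \<comment> \<open>Here \<open>q\<close> has a nonzero sign, but between two opposite signs it
        produces exactly one variation whichever it is.\<close>
      moreover have "Var_right (SRemSE p q) c = 1 + Var_right (SRemSE ?r t) c"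
      proof -
        have "sgn_right ?r c = - sgn_right p c"
          using rc pc by (simp only: sgn_right_nonroot sgn_minus neg_equal_0_iff_equal not_False_eq_True)
        then show ?thesis
          using sgn_right_cases[OF p, of c] sgn_right_cases[OF 3(1), of c]
          by (auto simp: eq t L Var_Cons_Cons)
      qed
      ultimately show ?thesis using IH by simp
    qed
  qed
qed

lemmas Var_at_SRemSE = Var_at_SRemSE_aux[THEN conjunct1, rule_format]

section \<open>Root counting and summation of the local drops\<close>

lemma Num_real_Un:
  assumes "P \<noteq> 0" "A \<inter> B = {}"
  shows "Num_real P (A \<union> B) = Num_real P A + Num_real P B"
proof -
  have "{x \<in> A \<union> B. poly P x = 0} = {x \<in> A. poly P x = 0} \<union> {x \<in> B. poly P x = 0}" by auto
  moreover have "finite {x \<in> S. poly P x = 0}" for S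
    by (rule finite_subset[OF _ poly_roots_finite[OF assms(1)]]) auto
  ultimately show ?thesis
    unfolding Num_real_def using assms(2) by (simp add: sum.union_disjoint disjoint_iff)
qed

lemma Num_real_cong:
  assumes "\<And>x. poly P x = 0 \<Longrightarrow> x \<in> A \<longleftrightarrow> x \<in> B"
  shows "Num_real P A = Num_real P B"
proof -
  have "{x \<in> A. poly P x = 0} = {x \<in> B. poly P x = 0}" using assms by auto
  then show ?thesis by (simp add: Num_real_def)
qed

lemma Num_real_empty [simp]: "Num_real P {} = 0"
  by (simp add: Num_real_def)

lemma Num_real_singleton: "P \<noteq> 0 \<Longrightarrow> Num_real P {x} = order x P"
  by (cases "poly P x = 0") (auto simp: Num_real_def order_root cong: conj_cong)

text \<open>Right-hand variations at \<open>a\<close> are taken after crossing \<open>a\<close>,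
  those at \<open>b\<close> after crossing \<open>b\<close>, which matches the half-open interval.
  Both sides are then additive under subdivision, so it suffices to treat short intervals around
  each point.\<close>

lemma Var_right_SRemSE_diff:
  assumes "P \<noteq> 0" "a \<le> b"
  shows "int (Num_real P {a<..b})
    = int (Var_right (SRemSE P (pderiv P)) a) - int (Var_right (SRemSE P (pderiv P)) b)"
  using assms(2)
proof (induction rule: Bolzano)
  case (trans a b c)
  have "{a<..c} = {a<..b} \<union> {b<..c}" using trans by auto
  then have "Num_real P {a<..c} = Num_real P {a<..b} + Num_real P {b<..c}"
    using Num_real_Un[OF assms(1), of "{a<..b}" "{b<..c}"] by auto
  with trans show ?case by simp
next
  case (local x)
  define L where "L = SRemSE P (pderiv P)"
  have PL: "P \<in> set L" using SRemSE_Cons[OF assms(1), of "pderiv P"] by (auto simp: L_def)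
  have nz: "p \<noteq> 0" if "p \<in> set L" for p using SRemSE_nonzero that by (simp add: L_def)
  \<comment> \<open>The list is finite, so one neighbourhood of \<open>x\<close> serves all its
    entries.\<close>
  have "eventually (\<lambda>y. \<forall>p\<in>set L. sgn (poly p y) = sgn (y - x) ^ order x p * sgn_right p x) (nhds x)"
    by (intro eventually_ball_finite ballI eventually_sgn_poly nz) auto
  then obtain d where d: "d > 0" and sgn:
    "\<And>y p. \<bar>y - x\<bar> < d \<Longrightarrow> p \<in> set L \<Longrightarrow> sgn (poly p y) = sgn (y - x) ^ order x p * sgn_right p x"
    unfolding eventually_nhds_metric dist_real_def by blast
  have nonroot: "poly p y \<noteq> 0" if "p \<in> set L" "\<bar>y - x\<bar> < d" "y \<noteq> x" for p y
    using sgn[OF that(2,1)] sgn_right_cases[OF nz[OF that(1)], of x] that(3)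
    by (auto simp: sgn_eq_0_iff)
  have right: "Var_right L v = Var_right L x" if "x \<le> v" "v < x + d" for v
  proof (cases "v = x")
    case False
    then have "sgn_right p v = sgn_right p x" if "p \<in> set L" for p
      using sgn[of v p] nonroot[of p v] that \<open>x \<le> v\<close> \<open>v < x + d\<close> by (simp add: sgn_right_nonroot)
    then show ?thesis by (simp cong: map_cong)
  qed simp
  \<comment> \<open>No entry vanishes at \<open>u\<close>, so right-hand signs at \<open>u\<close>
    are signs of values, which are the left-hand signs at \<open>x\<close>.\<close>
  have left: "Var_right L u = Var_left L x" if "u < x" "x - d < u" for u
  proof -
    have "sgn_right p u = sgn_left p x" if "p \<in> set L" for p
      using sgn[of u p] nonroot[of p u] that \<open>u < x\<close> \<open>x - d < u\<close>
      by (simp add: sgn_right_nonroot sgn_left_def)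
    then show ?thesis by (simp cong: map_cong)
  qed
  have "int (Num_real P {u<..v}) = int (Var_right L u) - int (Var_right L v)"
    if uv: "u \<le> x" "x \<le> v" "v - u < d" for u v
  proof (cases "u = x")
    case True
    have "Num_real P {u<..v} = Num_real P {}"
      by (rule Num_real_cong) (use nonroot[OF PL] uv True in force)
    with True right[of v] uv show ?thesis by simp
  next
    case False
    \<comment> \<open>Only \<open>x\<close> can be a root in this interval, and the local drop there
      is its multiplicity.\<close>
    have "Num_real P {u<..v} = Num_real P {x}"
      by (rule Num_real_cong) (use nonroot[OF PL] uv False in force)
    then show ?thesis
      using left[of u] right[of v] uv False Var_drop_SRemSE_pderiv[OF assms(1), of x]
      by (simp add: Num_real_singleton[OF assms(1)] L_def)
  qed
  with d show ?case unfolding L_def by blast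
qed

theorem theorem4p5:
  fixes P :: "real poly" and a b :: real
  assumes "a < b" and "poly P a \<noteq> 0" and "poly P b \<noteq> 0"
  shows "int (Num_real P {a<..<b}) = Var_between (SRemSE P (pderiv P)) a b"
proof -
  have P: "P \<noteq> 0" using assms(2) by auto
  have "Num_real P {a<..<b} = Num_real P {a<..b}"
    by (rule Num_real_cong) (use assms(3) in \<open>auto simp: less_le\<close>)
  then show ?thesis
    using Var_right_SRemSE_diff[OF P, of a b] assms by (simp add: Var_between_def Var_at_SRemSE)
qed

end
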